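(* Let $n_1,\ldots,n_t$ be even positive integers and $n=\max\{n_1,\ldots,n_t\}$. Suppose that for each $1\leq i\leq t$ we have $n_i\geq 2\lceil \log (81^t n) \rceil+2$. Then for sufficiently large $n$, $$\hat{R}(C_{n_1},\ldots,C_{n_t})\leq 2\times 81^{2t} (t\ln 81+1)\, n.$$
   Context: $C_k$ denotes the cycle on $k$ vertices. For graphs $G_1,\ldots,G_k$, the size-Ramsey number $\hat{R}(G_1,\ldots,G_k)$ is the smallest integer $m$ for which there exists a graph $H$ with $m$ edges such that for every coloring of the edges of $H$ with colors $1,\ldots,k$ there is, for some $i$, a copy of $G_i$ in $H$ all of whose edges have color $i$. $\log$ denotes the logarithm to base $2$ and $\ln$ the natural logarithm. *)

theory Defs
  imports Complex_Main
begin

definition is_graph :: "nat set set \<Rightarrow> bool" where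
  "is_graph E \<longleftrightarrow> finite E \<and> (\<forall>e\<in>E. card e = 2)"

definition has_cycle :: "nat set set \<Rightarrow> nat \<Rightarrow> bool" where
  "has_cycle E k \<longleftrightarrow> (\<exists>f::nat \<Rightarrow> nat. inj_on f {..<k} \<and> (\<forall>j<k. {f j, f (Suc j mod k)} \<in> E))"

definition cycle_arrows :: "nat set set \<Rightarrow> nat list \<Rightarrow> bool" where
  "cycle_arrows E ns \<longleftrightarrow>
     (\<forall>c::nat set \<Rightarrow> nat. (\<forall>e\<in>E. c e < length ns) \<longrightarrow>
        (\<exists>i<length ns. has_cycle {e\<in>E. c e = i} (ns ! i)))"

definition size_ramsey_cycles :: "nat list \<Rightarrow> nat" where
  "size_ramsey_cycles ns = (LEAST m. \<exists>E. is_graph E \<and> card E = m \<and> cycle_arrows E ns)"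

end

theory Submission
  imports Defs
begin

text \<open>The host is a random bipartite graph with sides of size \<open>81\<^sup>t n\<close> in which any two sets of
  \<open>n\<close> vertices on opposite sides span an edge. A bipartite graph with sides of size \<open>81 s\<close> in which
  any two \<open>s\<close>-sets on opposite sides span an edge contains all even cycles whose length lies between
  \<open>2 log s\<close> (roughly) and \<open>s\<close>: from the two ends of a path found by depth-first search one grows
  levels of doubling size in two disjoint expanding regions until they can be joined by an edge.
  Hence each colour without its cycle misses some pair of sets that is smaller by a factor of 81
  only, and after \<open>t\<close> such steps two \<open>n\<close>-sets without any edge would be left.\<close>

section \<open>Joined pairs and neighbourhoods\<close>

definition joined :: "'a set set \<Rightarrow> nat \<Rightarrow> 'a set \<Rightarrow> 'a set \<Rightarrow> bool" where
  "joined E s X Y \<longleftrightarrow>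
     (\<forall>A\<subseteq>X. \<forall>B\<subseteq>Y. card A = s \<and> card B = s \<longrightarrow> (\<exists>a\<in>A. \<exists>b\<in>B. {a, b} \<in> E))"

definition nbrs :: "'a set set \<Rightarrow> 'a set \<Rightarrow> 'a set \<Rightarrow> 'a set" where
  "nbrs E Z W = {w\<in>W. \<exists>z\<in>Z. {z, w} \<in> E}"

lemma joined_sym: "joined E s X Y \<Longrightarrow> joined E s Y X"
  unfolding joined_def by (metis insert_commute)

lemma joined_mono: "joined E s X Y \<Longrightarrow> X' \<subseteq> X \<Longrightarrow> Y' \<subseteq> Y \<Longrightarrow> joined E s X' Y'"
  unfolding joined_def by (simp add: subset_trans[of _ X' X] subset_trans[of _ Y' Y])

lemma joined_ge:
  assumes "joined E s X Y" "A \<subseteq> X" "B \<subseteq> Y" "s \<le> card A" "s \<le> card B"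
  obtains a b where "a \<in> A" "b \<in> B" "{a, b} \<in> E"
proof -
  obtain A' where A': "A' \<subseteq> A" "card A' = s" using assms(4) obtain_subset_with_card_n by blast
  obtain B' where B': "B' \<subseteq> B" "card B' = s" using assms(5) obtain_subset_with_card_n by blast
  have "A' \<subseteq> X" "B' \<subseteq> Y" using A' B' assms(2,3) by auto
  then have "\<exists>a\<in>A'. \<exists>b\<in>B'. {a, b} \<in> E" using assms(1) A'(2) B'(2) unfolding joined_def by blast
  then show thesis using that A' B' by blast
qed

text \<open>Vertices of \<open>W\<close> outside the neighbourhood have no edge to \<open>A\<close>,
  so joinedness allows fewer than \<open>s\<close> of them.\<close>

lemma joined_nbrs_card:
  assumes "joined E s X Y" "A \<subseteq> X" "s \<le> card A" "W \<subseteq> Y" "finite W"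
  shows "card W < s + card (nbrs E A W)"
proof (rule ccontr)
  assume "\<not> ?thesis"
  moreover have "card (W - nbrs E A W) = card W - card (nbrs E A W)"
    using assms(5) by (intro card_Diff_subset) (auto simp: nbrs_def intro: finite_subset)
  ultimately have "s \<le> card (W - nbrs E A W)" by linarith
  with assms obtain a b where "a \<in> A" "b \<in> W - nbrs E A W" "{a, b} \<in> E"
    using joined_ge[of E s X Y A "W - nbrs E A W"] by blast
  then show False by (auto simp: nbrs_def)
qed

section \<open>Expanding subsets of a joined pair\<close>

text \<open>Remove a maximal pair of small, badly expanding sets: if a further badly expanding set
  were left, its union with the removed one would either contradict maximality, or have at least
  \<open>s\<close> elements and too few neighbours for joinedness.\<close>

lemma joined_imp_expander:
  assumes J: "joined E s X Y" and fin: "finite X" "finite Y"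
    and card: "10 * s \<le> card X" "10 * s \<le> card Y" and s: "s > 0"
  obtains U W where "U \<subseteq> X" "W \<subseteq> Y" "card X < card U + s" "card Y < card W + s"
    "\<And>Z. Z \<subseteq> U \<Longrightarrow> card Z < s \<Longrightarrow> 4 * card Z \<le> card (nbrs E Z W)"
    "\<And>Z. Z \<subseteq> W \<Longrightarrow> card Z < s \<Longrightarrow> 4 * card Z \<le> card (nbrs E Z U)"
proof -
  \<comment> \<open>Neighbours are counted outside the removed part of the other side, so enlarging
    \<open>A\<close> can only relax the condition on \<open>B\<close>, and conversely.\<close>
  define Q where "Q = (\<lambda>(A, B). A \<subseteq> X \<and> B \<subseteq> Y \<and> card A < s \<and> card B < s \<and>
     card (nbrs E A (Y - B)) \<le> 4 * card A \<and> card (nbrs E B (X - A)) \<le> 4 * card B)"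
  have "Q ({}, {})" using s by (auto simp: Q_def nbrs_def)
  moreover have "\<forall>p. Q p \<longrightarrow> card (fst p) + card (snd p) < 2 * s" by (auto simp: Q_def)
  ultimately obtain p where "Q p"
    and max: "\<And>q. Q q \<Longrightarrow> card (fst q) + card (snd q) \<le> card (fst p) + card (snd p)"
    using ex_has_greatest_nat[of Q "({}, {})" "\<lambda>p. card (fst p) + card (snd p)" "2 * s"]
    by (metis less_imp_le)
  moreover obtain A B where p: "p = (A, B)" by fastforce
  ultimately have AB: "A \<subseteq> X" "B \<subseteq> Y" "card A < s" "card B < s"
     "card (nbrs E A (Y - B)) \<le> 4 * card A" "card (nbrs E B (X - A)) \<le> 4 * card B"
    by (auto simp: Q_def)
  have finAB: "finite A" "finite B" using AB fin finite_subset by blast+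
  \<comment> \<open>Generic \<open>X'\<close> and \<open>Y'\<close> let this serve both sides;
    \<open>mx\<close> is maximality with \<open>B'\<close> kept fixed.\<close>
  have key: "4 * card Z \<le> card (nbrs E Z (Y' - B'))"
    if J': "joined E s X' Y'" and fin': "finite X'" "finite Y'" and "10 * s \<le> card Y'"
      and A': "A' \<subseteq> X'" "card A' < s" "card (nbrs E A' (Y' - B')) \<le> 4 * card A'"
      and B': "B' \<subseteq> Y'" "card B' < s" "card (nbrs E B' (X' - A')) \<le> 4 * card B'"
      and Z: "Z \<subseteq> X' - A'" "card Z < s"
      and mx: "\<And>C. \<lbrakk>C \<subseteq> X'; card C < s; card (nbrs E C (Y' - B')) \<le> 4 * card C;
          card (nbrs E B' (X' - C)) \<le> 4 * card B'\<rbrakk> \<Longrightarrow> card C \<le> card A'"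
    for X' Y' A' B' Z
  proof (rule ccontr)
    assume neg: "\<not> ?thesis"
    have finZ: "finite Z" "finite A'" "finite B'"
      using Z A' B' fin' by (meson Diff_subset finite_subset order_trans)+
    have "Z \<noteq> {}" using neg by auto
    have cu: "card (A' \<union> Z) = card A' + card Z"
      using Z finZ by (intro card_Un_disjoint) auto
    have "nbrs E (A' \<union> Z) (Y' - B') \<subseteq> nbrs E A' (Y' - B') \<union> nbrs E Z (Y' - B')"
      by (auto simp: nbrs_def)
    then have "card (nbrs E (A' \<union> Z) (Y' - B')) \<le> card (nbrs E A' (Y' - B') \<union> nbrs E Z (Y' - B'))"
      using fin' by (intro card_mono) (auto simp: nbrs_def)
    also have "\<dots> \<le> card (nbrs E A' (Y' - B')) + card (nbrs E Z (Y' - B'))"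
      by (rule card_Un_le)
    finally have n1: "card (nbrs E (A' \<union> Z) (Y' - B')) \<le> 4 * card (A' \<union> Z)"
      using neg A' cu by linarith
    have "card (nbrs E B' (X' - (A' \<union> Z))) \<le> card (nbrs E B' (X' - A'))"
      using fin' by (intro card_mono) (auto simp: nbrs_def)
    then have n2: "card (nbrs E B' (X' - (A' \<union> Z))) \<le> 4 * card B'" using B' by linarith
    have sub: "A' \<union> Z \<subseteq> X'" using A' Z by auto
    have "card Z > 0" using \<open>Z \<noteq> {}\<close> finZ by auto
    then have ge: "s \<le> card (A' \<union> Z)" using mx[OF sub _ n1 n2] cu by linarith
    \<comment> \<open>The union has fewer than \<open>2 * s\<close> vertices, hence fewer than
      \<open>8 * s\<close> neighbours; with fewer than \<open>s\<close> missed vertices and fewer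
      than \<open>s\<close> removed ones this gives \<open>card Y' < 10 * s\<close>.\<close>
    have "card (Y' - B') < s + card (nbrs E (A' \<union> Z) (Y' - B'))"
      by (rule joined_nbrs_card[OF J' sub ge]) (use fin' in auto)
    moreover have "card (Y' - B') = card Y' - card B'"
      using finZ B' by (intro card_Diff_subset) auto
    ultimately show False using n1 cu A' B' Z that(4) by linarith
  qed
  show thesis
  proof
    show "X - A \<subseteq> X" "Y - B \<subseteq> Y" by auto
    show "card X < card (X - A) + s" "card Y < card (Y - B) + s"
      using AB finAB by (simp_all add: card_Diff_subset)
    show "4 * card Z \<le> card (nbrs E Z (Y - B))" if "Z \<subseteq> X - A" "card Z < s" for Z
    proof (rule key[OF J fin card(2) AB(1,3,5) AB(2,4,6) that])
      fix C assume "C \<subseteq> X" "card C < s" "card (nbrs E C (Y - B)) \<le> 4 * card C"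
        "card (nbrs E B (X - C)) \<le> 4 * card B"
      then show "card C \<le> card A" using max[of "(C, B)"] AB by (simp add: Q_def p)
    qed
    show "4 * card Z \<le> card (nbrs E Z (X - A))" if "Z \<subseteq> Y - B" "card Z < s" for Z
    proof (rule key[OF joined_sym[OF J] fin(2,1) card(1) AB(2,4,6) AB(1,3,5) that])
      fix C assume "C \<subseteq> Y" "card C < s" "card (nbrs E C (X - A)) \<le> 4 * card C"
        "card (nbrs E A (Y - C)) \<le> 4 * card A"
      then show "card C \<le> card B" using max[of "(A, C)"] AB by (simp add: Q_def p)
    qed
  qed
qed

section \<open>Paths, closed paths and levels grown in an expander\<close>

definition is_path :: "'a set set \<Rightarrow> 'a list \<Rightarrow> bool" where
  "is_path E xs \<longleftrightarrow> distinct xs \<and> successively (\<lambda>u v. {u, v} \<in> E) xs"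

lemma is_path_Cons:
  "is_path E (v # xs) \<longleftrightarrow> v \<notin> set xs \<and> is_path E xs \<and> (xs = [] \<or> {v, hd xs} \<in> E)"
  by (cases xs) (auto simp: is_path_def)

lemma is_path_append:
  "is_path E (xs @ ys) \<longleftrightarrow> is_path E xs \<and> is_path E ys \<and> set xs \<inter> set ys = {} \<and>
     (xs = [] \<or> ys = [] \<or> {last xs, hd ys} \<in> E)"
  by (auto simp: is_path_def successively_append_iff)

lemma is_path_rev: "is_path E (rev xs) \<longleftrightarrow> is_path E xs"
  by (simp add: is_path_def insert_commute)

lemma is_path_side:
  fixes S :: "'a \<Rightarrow> bool"
  assumes "is_path E xs" "xs \<noteq> []"
    and side: "\<And>u v. {u, v} \<in> E \<Longrightarrow> S u \<noteq> S v"
  shows "S (hd xs) = S (last xs) \<longleftrightarrow> odd (length xs)"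
  using assms(1,2)
proof (induction xs)
  case (Cons v xs)
  show ?case
  proof (cases "xs = []")
    case False
    then have "S v \<noteq> S (hd xs)" using Cons.prems side by (auto simp: is_path_Cons)
    then show ?thesis using Cons False by (auto simp: is_path_Cons)
  qed simp
qed simp

lemma has_cycle_if_closed_path:
  assumes "is_path E xs" "xs \<noteq> []" "{last xs, hd xs} \<in> E"
  shows "has_cycle E (length xs)"
  unfolding has_cycle_def
proof (intro exI conjI allI impI)
  show "inj_on ((!) xs) {..<length xs}"
    using assms(1) by (auto simp: is_path_def inj_on_def nth_eq_iff_index_eq)
  fix j assume j: "j < length xs"
  show "{xs ! j, xs ! (Suc j mod length xs)} \<in> E"
  proof (cases "Suc j < length xs")
    case True
    then show ?thesis using assms(1) by (auto simp: is_path_def successively_conv_nth)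
  next
    case False
    then have "Suc j = length xs" using j by simp
    then have "j = length xs - 1" "Suc j mod length xs = 0" by auto
    then show ?thesis using assms by (simp add: last_conv_nth hd_conv_nth)
  qed
qed

text \<open>Only sets within one class of the two-colouring \<open>S\<close> are tested; this
  suffices for growing levels, which alternate between the classes.\<close>

definition expander :: "'a set set \<Rightarrow> ('a \<Rightarrow> bool) \<Rightarrow> nat \<Rightarrow> 'a set \<Rightarrow> bool" where
  "expander E S s V \<longleftrightarrow>
     (\<forall>b. \<forall>Z\<subseteq>{v\<in>V. S v = b}. card Z < s \<longrightarrow> 4 * card Z \<le> card (nbrs E Z V))"

text \<open>A level has at least \<open>4 * 2 ^ d\<close> neighbours and \<open>C\<close> fewer than
  \<open>2 * 2 ^ d\<close> vertices, which leaves room for a new level of exactly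
  \<open>2 ^ (d + 1)\<close>. Cutting levels to this size keeps \<open>C\<close> small, and choosing
  them outside \<open>C\<close> lets the old paths be extended. The bound
  \<open>2 ^ d < 2 * s\<close> makes every earlier level smaller than \<open>s\<close>, as expansion
  requires.\<close>

lemma expander_grow_levels:
  fixes S :: "'a \<Rightarrow> bool"
  assumes exp: "expander E S s V"
    and side: "\<And>u v. {u, v} \<in> E \<Longrightarrow> S u \<noteq> S v"
    and "finite V" "r \<in> V" "2 ^ d < 2 * s"
  shows "\<exists>L C. L \<subseteq> C \<and> C \<subseteq> V \<and> card L = 2 ^ d \<and> card C < 2 ^ (d + 1) \<and>
     (\<forall>v\<in>L. (S v = S r \<longleftrightarrow> even d) \<and>
        (\<exists>xs. is_path E xs \<and> set xs \<subseteq> C \<and> length xs = d + 1 \<and> hd xs = v \<and> last xs = r))"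
  using assms(5)
proof (induction d)
  case 0
  show ?case
    by (rule exI[of _ "{r}"], rule exI[of _ "{r}"])
       (use \<open>r \<in> V\<close> in \<open>auto intro!: exI[of _ "[r]"] simp: is_path_def\<close>)
next
  case (Suc d)
  then obtain L C where LC: "L \<subseteq> C" "C \<subseteq> V" "card L = 2 ^ d" "card C < 2 ^ (d + 1)"
    and L: "\<And>v. v \<in> L \<Longrightarrow> S v = S r \<longleftrightarrow> even d"
    and P: "\<And>v. v \<in> L \<Longrightarrow>
      \<exists>xs. is_path E xs \<and> set xs \<subseteq> C \<and> length xs = d + 1 \<and> hd xs = v \<and> last xs = r"
    by auto
  have finC: "finite C" using LC \<open>finite V\<close> finite_subset by blast
  have "L \<subseteq> {v\<in>V. S v = (S r = even d)}" using LC L by auto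
  moreover have "card L < s" using LC(3) Suc.prems by simp
  ultimately have "4 * card L \<le> card (nbrs E L V)" using exp unfolding expander_def by blast
  moreover have "card (nbrs E L V) - card C \<le> card (nbrs E L V - C)"
    using finC by (rule diff_card_le_card_Diff)
  ultimately have "2 ^ Suc d \<le> card (nbrs E L V - C)" using LC by simp
  then obtain L' where L': "L' \<subseteq> nbrs E L V - C" "card L' = 2 ^ Suc d"
    by (rule obtain_subset_with_card_n)
  have "card (C \<union> L') \<le> card C + card L'" by (rule card_Un_le)
  then have "card (C \<union> L') < 2 ^ (Suc d + 1)" using LC L' by simp
  moreover have "(S v = S r \<longleftrightarrow> even (Suc d)) \<and> (\<exists>xs. is_path E xs \<and> set xs \<subseteq> C \<union> L' \<and>
      length xs = Suc d + 1 \<and> hd xs = v \<and> last xs = r)" if "v \<in> L'" for v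
  proof -
    from that L' obtain u where u: "u \<in> L" "{u, v} \<in> E" "v \<notin> C" by (auto simp: nbrs_def)
    obtain xs where xs: "is_path E xs" "set xs \<subseteq> C" "length xs = d + 1" "hd xs = u" "last xs = r"
      using P[OF u(1)] by blast
    have "is_path E (v # xs)" using u xs by (auto simp: is_path_Cons insert_commute)
    moreover have "set (v # xs) \<subseteq> C \<union> L'" using xs that by auto
    moreover have "length (v # xs) = Suc d + 1" "last (v # xs) = r" using xs by auto
    moreover have "hd (v # xs) = v" by simp
    ultimately have "\<exists>xs. is_path E xs \<and> set xs \<subseteq> C \<union> L' \<and>
      length xs = Suc d + 1 \<and> hd xs = v \<and> last xs = r" by blast
    then show ?thesis using side[OF u(2)] L[OF u(1)] by auto
  qed
  moreover have "C \<union> L' \<subseteq> V" using LC L' by (auto simp: nbrs_def)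
  ultimately show ?case using L'(2) by (intro exI[of _ L'] exI[of _ "C \<union> L'"]) auto
qed

section \<open>Long paths by depth-first search\<close>

text \<open>Depth-first search: \<open>R\<close> is the set of unvisited vertices, \<open>xs\<close> the current stack and \<open>T\<close> the
  set of finished vertices. No edge runs between \<open>T\<close> and \<open>R\<close>, so as long as the stack is short,
  joinedness prevents either side of \<open>T\<close> from ever reaching size \<open>s\<close>.\<close>

lemma joined_imp_path_aux:
  assumes J: "joined E s X Y" and fin: "finite X" "finite Y" and disj: "X \<inter> Y = {}"
    and card: "2 * s + p \<le> card X" "2 * s + p \<le> card Y"
    and "is_path E xs" "length xs \<le> p" "R \<union> T \<union> set xs = X \<union> Y"
    and "R \<inter> T = {}" "R \<inter> set xs = {}"
    and "\<And>u v. u \<in> T \<Longrightarrow> v \<in> R \<Longrightarrow> {u, v} \<notin> E"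
    and "card (T \<inter> X) < s" "card (T \<inter> Y) < s"
  shows "\<exists>ys. is_path E ys \<and> length ys = p \<and> set ys \<subseteq> X \<union> Y"
  using assms(7-)
\<comment> \<open>A push moves a vertex from \<open>R\<close> to the stack, a pop removes one from
  the stack; weight two on \<open>R\<close> makes both lower the measure.\<close>
proof (induction "2 * card R + length xs" arbitrary: xs R T rule: less_induct)
  case less
  note prems = less.prems
  have finR: "finite R" "finite T" using prems(3) fin by (metis finite_Un)+
  \<comment> \<open>Of at least \<open>2 * s + p\<close> vertices, the finished ones account for
    fewer than \<open>s\<close> and the stack for fewer than \<open>p\<close>.\<close>
  have big: "s < card (R \<inter> W)" if "W = X \<or> W = Y" "length xs < p" for W
  proof -
    have "W \<subseteq> (R \<inter> W) \<union> (T \<inter> W) \<union> set xs" using prems(3) that by blast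
    then have "card W \<le> card ((R \<inter> W) \<union> (T \<inter> W) \<union> set xs)"
      using finR by (intro card_mono) auto
    also have "\<dots> \<le> card (R \<inter> W) + card (T \<inter> W) + card (set xs)"
      by (meson card_Un_le add_le_mono1 order_trans)
    finally show ?thesis using card prems(7,8) that card_length[of xs] by fastforce
  qed
  \<comment> \<open>Done, push or pop; an empty stack falls under push, as the search may restart at
    any unvisited vertex.\<close>
  consider "length xs = p" | v where "length xs < p" "v \<in> R" "xs = [] \<or> {v, hd xs} \<in> E"
    | x xs' where "length xs < p" "xs = x # xs'" "\<And>v. v \<in> R \<Longrightarrow> {v, x} \<notin> E"
  proof (cases "length xs = p")
    case False
    then have lt: "length xs < p" using prems(2) by simp
    show thesis
    proof (cases xs)
      case Nil
      have "R \<inter> X \<noteq> {}" using big[of X] lt by auto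
      then show thesis using that(2) lt Nil by blast
    next
      case (Cons x xs')
      then show thesis using that(2,3) lt by (metis list.sel(1))
    qed
  qed (use that in blast)
  then show ?case
  proof cases
    case 1
    then show ?thesis using prems by blast
  next
    case 2
    show ?thesis
    proof (rule less.hyps[of "R - {v}" "v # xs" T])
      have "card R > 0" "card (R - {v}) = card R - 1" using 2 finR by (auto simp: card_gt_0_iff)
      then show "2 * card (R - {v}) + length (v # xs) < 2 * card R + length xs"
        by simp
      show "is_path E (v # xs)" using 2 prems by (auto simp: is_path_Cons)
    qed (use 2 prems in auto)
  next
    case 3
    have x: "x \<notin> R" "x \<notin> set xs'" using prems 3 by (auto simp: is_path_Cons)
    have noedge: "{u, v} \<notin> E" if "u \<in> insert x T" "v \<in> R" for u v
      using that prems(6) 3(3) by (metis insertE insert_commute)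
    have small: "card (insert x T \<inter> W) < s"
      if "W = X \<and> W' = Y \<or> W = Y \<and> W' = X" for W W'
    proof (rule ccontr)
      assume "\<not> ?thesis"
      moreover have "joined E s W W'" using that J joined_sym by blast
      moreover have "s \<le> card (R \<inter> W')" using big[of W'] 3 that by auto
      ultimately obtain a b where "a \<in> insert x T \<inter> W" "b \<in> R \<inter> W'" "{a, b} \<in> E"
        using joined_ge[of E s W W' "insert x T \<inter> W" "R \<inter> W'"] by auto
      then show False using noedge by blast
    qed
    show ?thesis
    proof (rule less.hyps[of R xs' "insert x T"])
      show "is_path E xs'" using 3 prems by (auto simp: is_path_Cons)
      show "card (insert x T \<inter> X) < s" "card (insert x T \<inter> Y) < s" using small by blast+
    qed (use 3 prems x noedge in auto)
  qed
qed

lemma joined_imp_path: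
  assumes "joined E s X Y" "finite X" "finite Y" "X \<inter> Y = {}" "s > 0"
    "2 * s + p \<le> card X" "2 * s + p \<le> card Y"
  obtains ys where "is_path E ys" "length ys = p" "set ys \<subseteq> X \<union> Y"
  using joined_imp_path_aux[of E s X Y p "[]" "X \<union> Y" "{}"] assms
  by (auto simp: is_path_def)

section \<open>Even cycles from joinedness\<close>

text \<open>The lower bounds on both sides of \<open>V\<close> serve to attach a path: all but fewer
  than \<open>s\<close> vertices opposite such a side have a neighbour in it.\<close>

lemma joined_imp_side_expander:
  fixes S :: "'a \<Rightarrow> bool"
  assumes "joined E s X Y" "finite X" "finite Y" "10 * s \<le> card X" "10 * s \<le> card Y" "s > 0"
    and S: "\<And>x. x \<in> X \<Longrightarrow> S x" "\<And>y. y \<in> Y \<Longrightarrow> \<not> S y"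
  obtains V where "V \<subseteq> X \<union> Y" "s \<le> card (V \<inter> X)" "s \<le> card (V \<inter> Y)"
    "expander E S s V"
proof -
  obtain U W where UW: "U \<subseteq> X" "W \<subseteq> Y" "card X < card U + s" "card Y < card W + s"
    and expU: "\<And>Z. Z \<subseteq> U \<Longrightarrow> card Z < s \<Longrightarrow> 4 * card Z \<le> card (nbrs E Z W)"
    and expW: "\<And>Z. Z \<subseteq> W \<Longrightarrow> card Z < s \<Longrightarrow> 4 * card Z \<le> card (nbrs E Z U)"
    using joined_imp_expander[OF assms(1-6)] by blast
  have disj: "X \<inter> Y = {}" using S by auto
  have fin: "finite (U \<union> W)" using UW assms(2,3) finite_subset by blast
  show thesis
  proof
    show "U \<union> W \<subseteq> X \<union> Y" using UW by auto
    have "(U \<union> W) \<inter> X = U" "(U \<union> W) \<inter> Y = W" using UW disj by auto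
    then show "s \<le> card ((U \<union> W) \<inter> X)" "s \<le> card ((U \<union> W) \<inter> Y)" using UW assms(4,5) by auto
    show "expander E S s (U \<union> W)"
      unfolding expander_def
    proof (intro allI impI)
      fix b Z assume Z: "Z \<subseteq> {v \<in> U \<union> W. S v = b}" "card Z < s"
      have "card (nbrs E Z U) \<le> card (nbrs E Z (U \<union> W))"
        "card (nbrs E Z W) \<le> card (nbrs E Z (U \<union> W))"
        using fin by (intro card_mono; auto simp: nbrs_def)+
      moreover have "Z \<subseteq> U \<or> Z \<subseteq> W" using Z(1) UW(1,2) S by (cases b) blast+
      ultimately show "4 * card Z \<le> card (nbrs E Z (U \<union> W))"
        using expU[of Z] expW[of Z] Z(2) by fastforce
    qed
  qed
qed

text \<open>Two disjoint regions of size \<open>10 s\<close> per side serve to grow levels from the two ends of a path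
  that lives in the remaining vertices; the last levels have at least \<open>s\<close> vertices each and lie on
  opposite sides, so an edge between them closes the cycle.\<close>

lemma joined_imp_even_cycle:
  fixes E :: "nat set set" and S :: "nat \<Rightarrow> bool"
  assumes J: "joined E s X Y" and fin: "finite X" "finite Y"
    and card: "81 * s \<le> card X" "81 * s \<le> card Y" and s: "s > 0"
    and side: "\<And>u v. {u, v} \<in> E \<Longrightarrow> S u \<noteq> S v"
    and S: "\<And>x. x \<in> X \<Longrightarrow> S x" "\<And>y. y \<in> Y \<Longrightarrow> \<not> S y"
    and d: "s \<le> 2 ^ d" "2 ^ d < 2 * s"
    and k: "even k" "2 * d + 4 \<le> k" "k \<le> s"
  shows "has_cycle E k"
proof -
  \<comment> \<open>Two regions of \<open>10 * s\<close> vertices leave \<open>61 * s\<close> for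
    the path.\<close>
  have split: "\<exists>A1 A2. A1 \<subseteq> A \<and> A2 \<subseteq> A \<and> A1 \<inter> A2 = {} \<and> card A1 = 10 * s \<and> card A2 = 10 * s \<and>
      61 * s \<le> card (A - A1 - A2)" if A: "finite A" "81 * s \<le> card A" for A :: "nat set"
  proof -
    obtain A1 where A1: "A1 \<subseteq> A" "card A1 = 10 * s"
      using obtain_subset_with_card_n[of "10 * s" A] A by auto
    have c: "card (A - A1) = card A - 10 * s"
      using A1 A by (simp add: card_Diff_subset finite_subset)
    have "10 * s \<le> card (A - A1)" using A c by simp
    then obtain A2 where A2: "A2 \<subseteq> A - A1" "card A2 = 10 * s"
      by (rule obtain_subset_with_card_n)
    have "card (A - A1 - A2) = card A - 20 * s"
      using A2 A c by (simp add: card_Diff_subset finite_subset)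
    then show ?thesis using A A1 A2 by (intro exI[of _ A1] exI[of _ A2]) auto
  qed
  obtain X1 X2 where X12: "X1 \<subseteq> X" "X2 \<subseteq> X" "X1 \<inter> X2 = {}" "card X1 = 10 * s" "card X2 = 10 * s"
    "61 * s \<le> card (X - X1 - X2)" using split[OF fin(1) card(1)] by blast
  obtain Y1 Y2 where Y12: "Y1 \<subseteq> Y" "Y2 \<subseteq> Y" "Y1 \<inter> Y2 = {}" "card Y1 = 10 * s" "card Y2 = 10 * s"
    "61 * s \<le> card (Y - Y1 - Y2)" using split[OF fin(2) card(2)] by blast
  have disj: "X \<inter> Y = {}" using S by auto
  have fin12: "finite X1" "finite X2" "finite Y1" "finite Y2"
    using X12 Y12 fin finite_subset by blast+
  obtain V1 where V1: "V1 \<subseteq> X1 \<union> Y1" "s \<le> card (V1 \<inter> X1)" "s \<le> card (V1 \<inter> Y1)"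
    and exp1: "expander E S s V1"
    by (rule joined_imp_side_expander[of E s X1 Y1 S])
       (use joined_mono[OF J X12(1) Y12(1)] fin12 X12 Y12 s S in auto)
  obtain V2 where V2: "V2 \<subseteq> X2 \<union> Y2" "s \<le> card (V2 \<inter> X2)" "s \<le> card (V2 \<inter> Y2)"
    and exp2: "expander E S s V2"
    by (rule joined_imp_side_expander[of E s X2 Y2 S])
       (use joined_mono[OF J X12(2) Y12(2)] fin12 X12 Y12 s S in auto)
  have finV: "finite V1" "finite V2" using V1 V2 fin12 finite_subset by blast+
  have J': "joined E s Y X" using J by (rule joined_sym)
  \<comment> \<open>Vertices with neighbours in both regions are kept, so each end of the path can
    be attached to either region. The two filters lose fewer than \<open>s\<close> vertices each,
    leaving \<open>59 * s\<close>.\<close>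
  define X0 where "X0 = nbrs E (V2 \<inter> Y2) (nbrs E (V1 \<inter> Y1) (X - X1 - X2))"
  define Y0 where "Y0 = nbrs E (V2 \<inter> X2) (nbrs E (V1 \<inter> X1) (Y - Y1 - Y2))"
  have sub0: "X0 \<subseteq> X - X1 - X2" "Y0 \<subseteq> Y - Y1 - Y2" by (auto simp: X0_def Y0_def nbrs_def)
  have "card (X - X1 - X2) < s + card (nbrs E (V1 \<inter> Y1) (X - X1 - X2))"
    by (rule joined_nbrs_card[OF J']) (use V1 Y12 fin in auto)
  moreover have "card (nbrs E (V1 \<inter> Y1) (X - X1 - X2)) < s + card X0"
    unfolding X0_def by (rule joined_nbrs_card[OF J']) (use V2 Y12 fin in \<open>auto simp: nbrs_def\<close>)
  ultimately have cX0: "59 * s \<le> card X0" using X12 by linarith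
  have "card (Y - Y1 - Y2) < s + card (nbrs E (V1 \<inter> X1) (Y - Y1 - Y2))"
    by (rule joined_nbrs_card[OF J]) (use V1 X12 fin in auto)
  moreover have "card (nbrs E (V1 \<inter> X1) (Y - Y1 - Y2)) < s + card Y0"
    unfolding Y0_def by (rule joined_nbrs_card[OF J]) (use V2 X12 fin in \<open>auto simp: nbrs_def\<close>)
  ultimately have cY0: "59 * s \<le> card Y0" using Y12 by linarith
  have nb: "(\<exists>w\<in>V1. {w, v} \<in> E) \<and> (\<exists>w\<in>V2. {w, v} \<in> E)" if "v \<in> X0 \<union> Y0" for v
    using that by (auto simp: X0_def Y0_def nbrs_def)
  \<comment> \<open>Each branch contributes \<open>d + 1\<close> vertices, root included, and the
    path the rest. Since \<open>p\<close> is even, the path ends, and hence the two roots, lie on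
    opposite sides.\<close>
  define p where "p = k - 2 * d - 2"
  have p: "even p" "p > 0" "k = p + 2 * d + 2" "p \<le> s" using k by (auto simp: p_def)
  obtain ys where ys: "is_path E ys" "length ys = p" "set ys \<subseteq> X0 \<union> Y0"
  proof (rule joined_imp_path[of E s X0 Y0 p])
    show "joined E s X0 Y0" using joined_mono[OF J] sub0 by blast
    show "finite X0" "finite Y0" using sub0 fin by (meson finite_Diff finite_subset)+
    show "X0 \<inter> Y0 = {}" using sub0 disj by auto
  qed (use s p cX0 cY0 in auto)
  have "ys \<noteq> []" using ys p by auto
  then have "hd ys \<in> X0 \<union> Y0" "last ys \<in> X0 \<union> Y0"
    using ys(3) hd_in_set[of ys] last_in_set[of ys] by blast+
  then obtain u0 v0 where u0: "u0 \<in> V1" "{u0, hd ys} \<in> E" and v0: "v0 \<in> V2" "{v0, last ys} \<in> E"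
    using nb by blast
  have "S (hd ys) \<noteq> S (last ys)"
    using is_path_side[of E ys S] ys p \<open>ys \<noteq> []\<close> side by auto
  then have uv: "S u0 \<noteq> S v0" using side[OF u0(2)] side[OF v0(2)] by auto
  obtain L1 C1 where L1: "L1 \<subseteq> C1" "C1 \<subseteq> V1" "card L1 = 2 ^ d"
    and P1: "\<And>v. v \<in> L1 \<Longrightarrow> (S v = S u0 \<longleftrightarrow> even d) \<and>
      (\<exists>xs. is_path E xs \<and> set xs \<subseteq> C1 \<and> length xs = d + 1 \<and> hd xs = v \<and> last xs = u0)"
    using expander_grow_levels[OF exp1 side finV(1) u0(1) d(2)] by metis
  obtain L2 C2 where L2: "L2 \<subseteq> C2" "C2 \<subseteq> V2" "card L2 = 2 ^ d"
    and P2: "\<And>v. v \<in> L2 \<Longrightarrow> (S v = S v0 \<longleftrightarrow> even d) \<and>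
      (\<exists>xs. is_path E xs \<and> set xs \<subseteq> C2 \<and> length xs = d + 1 \<and> hd xs = v \<and> last xs = v0)"
    using expander_grow_levels[OF exp2 side finV(2) v0(1) d(2)] by metis
  have VXY: "V1 \<subseteq> X \<union> Y" "V2 \<subseteq> X \<union> Y" using V1 V2 X12 Y12 by auto
  \<comment> \<open>Equally many levels grown from roots on opposite sides end on opposite
    sides.\<close>
  have S1: "S v \<longleftrightarrow> (S u0 \<longleftrightarrow> even d)" if "v \<in> L1" for v using P1[OF that] by auto
  have S2: "S v \<longleftrightarrow> \<not> (S u0 \<longleftrightarrow> even d)" if "v \<in> L2" for v using P2[OF that] uv by auto
  have "L1 \<subseteq> X \<union> Y" "L2 \<subseteq> X \<union> Y" using L1 L2 VXY by auto
  then have "L1 \<subseteq> X \<and> L2 \<subseteq> Y \<or> L1 \<subseteq> Y \<and> L2 \<subseteq> X"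
    using S1 S2 S by (cases "S u0 \<longleftrightarrow> even d") blast+
  then have "joined E s L1 L2" using joined_mono[OF J] joined_mono[OF J'] by blast
  then obtain a b where ab: "a \<in> L1" "b \<in> L2" "{a, b} \<in> E"
    by (rule joined_ge[of E s L1 L2 L1 L2]) (use d L1 L2 in auto)
  obtain xs1 where xs1: "is_path E xs1" "set xs1 \<subseteq> C1" "length xs1 = d + 1" "hd xs1 = a" "last xs1 = u0"
    using P1[OF ab(1)] by blast
  obtain xs2 where xs2: "is_path E xs2" "set xs2 \<subseteq> C2" "length xs2 = d + 1" "hd xs2 = b" "last xs2 = v0"
    using P2[OF ab(2)] by blast
  have ne: "xs1 \<noteq> []" "xs2 \<noteq> []" using xs1 xs2 by auto
  have d12: "V1 \<inter> V2 = {}" using V1 V2 X12 Y12 disj by blast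
  have d10: "V1 \<inter> (X0 \<union> Y0) = {}" using V1 sub0 X12 Y12 disj by blast
  have d20: "V2 \<inter> (X0 \<union> Y0) = {}" using V2 sub0 X12 Y12 disj by blast
  \<comment> \<open>From \<open>a\<close> to the root \<open>u0\<close>, along the path, then from
    \<open>v0\<close> to \<open>b\<close>; the edge between \<open>a\<close> and \<open>b\<close>
    closes the cycle.\<close>
  let ?c = "xs1 @ ys @ rev xs2"
  have "set xs1 \<inter> set ys = {}" "set xs2 \<inter> set ys = {}" "set xs1 \<inter> set xs2 = {}"
    using xs1(2) xs2(2) ys(3) L1(2) L2(2) d12 d10 d20 by blast+
  then have "is_path E ?c"
    using xs1 xs2 ys ne \<open>ys \<noteq> []\<close> u0 v0
    by (auto simp: is_path_append is_path_rev hd_rev insert_commute)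
  moreover have "{last ?c, hd ?c} \<in> E"
    using ab xs1 xs2 ne by (simp add: last_rev insert_commute)
  moreover have "length ?c = k" using xs1 xs2 ys p by simp
  ultimately show ?thesis using has_cycle_if_closed_path[of E ?c] ne by auto
qed

section \<open>Eliminating the colours one by one\<close>

lemma power_two_bracket:
  fixes s :: nat
  assumes "s > 0"
  obtains d where "s \<le> 2 ^ d" "2 ^ d < 2 * s"
proof -
  define d where "d = (LEAST d. s \<le> 2 ^ d)"
  have ge: "s \<le> 2 ^ d" unfolding d_def by (rule LeastI[of _ s]) (simp add: less_imp_le)
  have "2 ^ d < 2 * s"
  proof (cases d)
    case (Suc e)
    then have "\<not> s \<le> 2 ^ e" unfolding d_def using not_less_Least[of e "\<lambda>d. s \<le> 2 ^ d"] by auto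
    then show ?thesis using Suc by simp
  qed (use assms in simp)
  with ge show thesis using that by blast
qed

text \<open>The third condition on \<open>m\<close> is the logarithmic length bound, expressed
  through powers of two.\<close>

lemma joined_imp_monochromatic_cycle:
  fixes E :: "nat set set" and S :: "nat \<Rightarrow> bool"
  assumes J: "joined E n X Y" and fin: "finite X" "finite Y"
    and card: "card X = 81 ^ t * n" "card Y = 81 ^ t * n" and n: "n > 0"
    and side: "\<And>u v. {u, v} \<in> E \<Longrightarrow> S u \<noteq> S v"
    and S: "\<And>x. x \<in> X \<Longrightarrow> S x" "\<And>y. y \<in> Y \<Longrightarrow> \<not> S y"
    and c: "\<And>e. e \<in> E \<Longrightarrow> c e < t"
    and m: "\<And>i. i < t \<Longrightarrow> even (m i)" "\<And>i. i < t \<Longrightarrow> m i \<le> n"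
      "\<And>i d. i < t \<Longrightarrow> 2 ^ (d + 1) \<le> 81 ^ t * n \<Longrightarrow> 2 * d + 4 \<le> m i"
  shows "\<exists>i<t. has_cycle {e\<in>E. c e = i} (m i)"
proof (rule ccontr)
  assume neg: "\<not> ?thesis"
  \<comment> \<open>Induction on the number of colours ruled out: a colour without its cycle cannot
    join \<open>A\<close> and \<open>B\<close>, and sets witnessing this form the next pair.\<close>
  have "\<exists>A B. A \<subseteq> X \<and> B \<subseteq> Y \<and> card A = 81 ^ (t - j) * n \<and> card B = 81 ^ (t - j) * n \<and>
      (\<forall>a\<in>A. \<forall>b\<in>B. {a, b} \<in> E \<longrightarrow> j \<le> c {a, b})" if "j \<le> t" for j
    using that
  proof (induction j)
    case 0
    then show ?case using card by auto
  next
    case (Suc j)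
    then obtain A B where AB: "A \<subseteq> X" "B \<subseteq> Y" "card A = 81 ^ (t - j) * n" "card B = 81 ^ (t - j) * n"
      and col: "\<And>a b. a \<in> A \<Longrightarrow> b \<in> B \<Longrightarrow> {a, b} \<in> E \<Longrightarrow> j \<le> c {a, b}" by auto
    define s where "s = 81 ^ (t - Suc j) * n"
    have "t - j = Suc (t - Suc j)" using Suc.prems by simp
    then have s: "81 ^ (t - j) * n = 81 * s" by (simp add: s_def)
    have "s > 0" "n \<le> s" using n by (auto simp: s_def)
    obtain d where d: "s \<le> 2 ^ d" "2 ^ d < 2 * s" using power_two_bracket[OF \<open>s > 0\<close>] by blast
    \<comment> \<open>Since \<open>2 ^ (d + 1) < 4 * s\<close>, the power is well within
      \<open>81 * s\<close>, so the length bound for the original sides applies in every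
      round.\<close>
    have "81 ^ (t - j) * n \<le> 81 ^ t * n" by (intro mult_right_mono power_increasing) auto
    then have "2 ^ (d + 1) \<le> 81 ^ t * n" using d s by simp
    then have mj: "2 * d + 4 \<le> m j" using m(3)[of j d] Suc.prems by simp
    have "\<not> joined {e\<in>E. c e = j} s A B"
    proof
      assume "joined {e\<in>E. c e = j} s A B"
      then have "has_cycle {e\<in>E. c e = j} (m j)"
      proof (rule joined_imp_even_cycle[where S = S])
        show "finite A" "finite B" using AB fin finite_subset by blast+
        show "m j \<le> s" using m(2)[of j] Suc.prems \<open>n \<le> s\<close> by simp
      qed (use AB s \<open>s > 0\<close> side S d mj m(1) Suc.prems in auto)
      then show False using neg Suc.prems by auto
    qed
    then obtain A' B' where AB': "A' \<subseteq> A" "B' \<subseteq> B" "card A' = s" "card B' = s"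
      and no: "\<And>a b. a \<in> A' \<Longrightarrow> b \<in> B' \<Longrightarrow> {a, b} \<in> E \<Longrightarrow> c {a, b} \<noteq> j"
      unfolding joined_def by blast
    have "Suc j \<le> c {a, b}" if "a \<in> A'" "b \<in> B'" "{a, b} \<in> E" for a b
      using no[OF that] col[of a b] that AB' by fastforce
    then show ?case using AB AB' unfolding s_def
      by (intro exI[of _ A'] exI[of _ B']) auto
  qed
  \<comment> \<open>At \<open>j = t\<close> no colour remains for an edge between the two sets, yet
    the host supplies one.\<close>
  from this[of t] obtain A B where AB: "A \<subseteq> X" "B \<subseteq> Y" "card A = n" "card B = n"
    and ge: "\<forall>a\<in>A. \<forall>b\<in>B. {a, b} \<in> E \<longrightarrow> t \<le> c {a, b}" by auto
  obtain a b where "a \<in> A" "b \<in> B" "{a, b} \<in> E"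
    by (rule joined_ge[OF J AB(1,2)]) (use AB in auto)
  then show False using c[of "{a, b}"] ge by fastforce
qed

section \<open>The random host graph\<close>

text \<open>The terms of index \<open>n - 1\<close> and \<open>n\<close> in the exponential series
  at \<open>n\<close> coincide. The factor two gained here later absorbs rounding.\<close>

lemma two_power_self_le_exp_fact:
  assumes "n > 0"
  shows "2 * real n ^ n \<le> exp (real n) * fact n"
proof -
  obtain m where m: "n = Suc m" using assms gr0_conv_Suc by blast
  have s: "(\<lambda>k. real n ^ k /\<^sub>R fact k) sums exp (real n)" by (rule exp_converges)
  have "(\<Sum>k\<in>{m, n}. real n ^ k /\<^sub>R fact k) \<le> (\<Sum>k. real n ^ k /\<^sub>R fact k)"
    by (rule sum_le_suminf) (use s in \<open>auto simp: sums_iff\<close>)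
  then have "real n ^ m / fact m + real n ^ n / fact n \<le> exp (real n)"
    using s m by (simp add: sums_iff divide_inverse mult.commute)
  moreover have "real n ^ m / fact m = real n ^ n / fact n"
    by (simp add: m del: of_nat_Suc)
  ultimately show ?thesis by (simp add: field_simps)
qed

text \<open>A random pair hits a fixed \<open>n\<close> by \<open>n\<close> box with probability
  \<open>1 / q ^ 2\<close>, so this bounds the expected number of boxes missed by \<open>M\<close>
  pairs. Rounding of \<open>M\<close> may leave a positive exponent below 1; squaring the halved
  binomial bound gives a factor 1/4, and \<open>exp 1 < 4\<close>.\<close>

lemma choose_sq_bound:
  fixes q n M :: nat
  assumes "q > 0" "n > 0" and M: "2 * real q ^ 2 * (ln q + 1) * n < real M + 1"
  shows "real ((q * n) choose n) ^ 2 * (1 - 1 / real q ^ 2) ^ M < 1"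
proof -
  have q1: "1 / real q ^ 2 \<le> 1" using assms(1) by simp
  have "real ((q * n) choose n) * fact n = real (((q * n) choose n) * fact n)" by simp
  also have "\<dots> \<le> real ((q * n) ^ n)" by (intro of_nat_mono binomial_fact_pow)
  finally have "real ((q * n) choose n) * fact n * 2 \<le> real q ^ n * (2 * real n ^ n)"
    by (simp add: power_mult_distrib)
  also have "\<dots> \<le> real q ^ n * (exp (real n) * fact n)"
    by (intro mult_left_mono two_power_self_le_exp_fact assms) auto
  finally have "real ((q * n) choose n) * 2 * fact n \<le> real q ^ n * exp (real n) * fact n"
    by (simp add: algebra_simps)
  then have "real ((q * n) choose n) * 2 \<le> real q ^ n * exp (real n)"
    by (rule mult_right_le_imp_le) simp
  also have "real q ^ n = exp (real n * ln q)"
    using assms(1) by (simp add: exp_of_nat_mult)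
  finally have "real ((q * n) choose n) \<le> exp (real n * (ln q + 1)) / 2"
    by (simp add: distrib_left exp_add)
  then have "real ((q * n) choose n) ^ 2 \<le> (exp (real n * (ln q + 1)) / 2) ^ 2"
    by (intro power_mono) auto
  also have "\<dots> = exp (2 * (real n * (ln q + 1))) / 4"
    by (simp add: power_divide exp_double)
  finally have b1: "real ((q * n) choose n) ^ 2 \<le> exp (2 * (real n * (ln q + 1))) / 4" .
  have "(1 - 1 / real q ^ 2) ^ M \<le> exp (- (1 / real q ^ 2)) ^ M"
    using exp_ge_add_one_self[of "- (1 / real q ^ 2)"] q1 by (intro power_mono) auto
  also have "\<dots> = exp (- (real M / real q ^ 2))"
    by (simp flip: exp_of_nat_mult)
  finally have b2: "(1 - 1 / real q ^ 2) ^ M \<le> exp (- (real M / real q ^ 2))" .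
  have "2 * (real n * (ln q + 1)) < real M / real q ^ 2 + 1 / real q ^ 2"
    using M assms(1) by (simp add: field_simps)
  then have b3: "2 * (real n * (ln q + 1)) - real M / real q ^ 2 < 1" using q1 by linarith
  have "real ((q * n) choose n) ^ 2 * (1 - 1 / real q ^ 2) ^ M
      \<le> exp (2 * (real n * (ln q + 1))) / 4 * exp (- (real M / real q ^ 2))"
    by (intro mult_mono b1 b2) (use q1 in auto)
  also have "\<dots> = exp (2 * (real n * (ln q + 1)) - real M / real q ^ 2) / 4"
    by (simp add: exp_diff exp_minus field_simps)
  also have "\<dots> < exp 1 / 4" using b3 by simp
  also have "\<dots> < 1" using exp_le by simp
  finally show ?thesis .
qed

text \<open>First moment: count the lists of \<open>M\<close> pairs that avoid \<open>A \<times> B\<close> for some \<open>A\<close>, \<open>B\<close>.\<close>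

lemma exists_sparse_joined_pairs:
  fixes q n M :: nat
  assumes fin: "finite X" "finite Y" and card: "card X = q * n" "card Y = q * n"
    and "q > 0" "n > 0" and M: "2 * real q ^ 2 * (ln q + 1) * n < real M + 1"
  obtains P where "P \<subseteq> X \<times> Y" "card P \<le> M"
    "\<And>A B. A \<subseteq> X \<Longrightarrow> B \<subseteq> Y \<Longrightarrow> card A = n \<Longrightarrow> card B = n \<Longrightarrow> P \<inter> A \<times> B \<noteq> {}"
proof -
  define \<A> where "\<A> = {A. A \<subseteq> X \<and> card A = n} \<times> {B. B \<subseteq> Y \<and> card B = n}"
  \<comment> \<open>Lists allow repetition, so the counts are plain powers; repeated entries only
    shrink the resulting set.\<close>
  define bad where "bad = (\<lambda>(A, B). {xs. set xs \<subseteq> X \<times> Y - A \<times> B \<and> length xs = M})"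
  define all where "all = {xs. set xs \<subseteq> X \<times> Y \<and> length xs = M}"
  have fA: "finite \<A>" using fin by (auto simp: \<A>_def)
  have cA: "card \<A> = ((q * n) choose n) ^ 2"
    using fin card by (simp add: \<A>_def card_cartesian_product n_subsets power2_eq_square)
  have call: "card all = ((q * n) ^ 2) ^ M"
    using fin card by (simp add: all_def card_lists_length_eq card_cartesian_product power2_eq_square)
  have cbad: "card (bad p) = ((q * n) ^ 2 - n ^ 2) ^ M" if "p \<in> \<A>" for p
  proof -
    obtain A B where p: "p = (A, B)" by fastforce
    have AB: "A \<subseteq> X" "B \<subseteq> Y" "card A = n" "card B = n" using that p by (auto simp: \<A>_def)
    have "finite (A \<times> B)"
      using finite_subset[OF AB(1) fin(1)] finite_subset[OF AB(2) fin(2)] by simp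
    then have "card (X \<times> Y - A \<times> B) = (q * n) ^ 2 - n ^ 2"
      using AB card
      by (simp add: card_Diff_subset Sigma_mono card_cartesian_product power2_eq_square)
    then show ?thesis using fin by (simp add: bad_def p card_lists_length_eq)
  qed
  have "card (\<Union>(bad ` \<A>)) \<le> (\<Sum>p\<in>\<A>. card (bad p))" by (rule card_UN_le[OF fA])
  also have "\<dots> = ((q * n) choose n) ^ 2 * ((q * n) ^ 2 - n ^ 2) ^ M"
    using cbad cA by simp
  finally have "real (card (\<Union>(bad ` \<A>))) \<le> real (((q * n) choose n) ^ 2 * ((q * n) ^ 2 - n ^ 2) ^ M)"
    by (rule of_nat_mono)
  also have "\<dots> = real ((q * n) choose n) ^ 2 * (1 - 1 / real q ^ 2) ^ M * ((real (q * n)) ^ 2) ^ M"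
  proof -
    have "n ^ 2 \<le> (q * n) ^ 2" using \<open>q > 0\<close> by (intro power_mono) auto
    then have "real ((q * n) ^ 2 - n ^ 2) = (1 - 1 / real q ^ 2) * (real (q * n)) ^ 2"
      using \<open>q > 0\<close> by (simp add: of_nat_diff field_simps)
    then show ?thesis by (simp add: power_mult_distrib)
  qed
  also have "\<dots> < 1 * ((real (q * n)) ^ 2) ^ M"
    using choose_sq_bound[OF assms(5,6) M] assms(5,6) by (intro mult_strict_right_mono) auto
  also have "\<dots> = real (card all)" by (simp add: call)
  finally have "card (\<Union>(bad ` \<A>)) < card all" by simp
  moreover have "finite (\<Union>(bad ` \<A>))"
    using fA fin by (auto simp: bad_def intro!: finite_lists_length_eq)
  ultimately have "\<not> all \<subseteq> \<Union>(bad ` \<A>)" using card_mono linorder_not_less by blast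
  then obtain xs where xs: "set xs \<subseteq> X \<times> Y" "length xs = M" "\<And>p. p \<in> \<A> \<Longrightarrow> xs \<notin> bad p"
    by (auto simp: all_def)
  show thesis
  proof
    show "set xs \<subseteq> X \<times> Y" by (rule xs)
    show "card (set xs) \<le> M" using card_length xs(2) by blast
    show "set xs \<inter> A \<times> B \<noteq> {}" if "A \<subseteq> X" "B \<subseteq> Y" "card A = n" "card B = n" for A B
      using xs(3)[of "(A, B)"] that xs(1,2) unfolding \<A>_def bad_def by auto
  qed
qed

section \<open>The size-Ramsey bound\<close>

theorem theorem3p6:
  fixes t :: nat
  assumes "t \<ge> 1"
  shows "\<exists>N::nat. \<forall>ns::nat list.
     length ns = t \<longrightarrow>
     (\<forall>i<t. even (ns ! i) \<and> ns ! i > 0 \<and>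
        real (ns ! i) \<ge> 2 * of_int \<lceil>log 2 (81 ^ t * real (Max (set ns)))\<rceil> + 2) \<longrightarrow>
     Max (set ns) \<ge> N \<longrightarrow>
     real (size_ramsey_cycles ns) \<le> 2 * 81 ^ (2 * t) * (real t * ln 81 + 1) * real (Max (set ns))"
proof (intro exI[of _ 1] allI impI)
  fix ns :: "nat list"
  assume len: "length ns = t" and n1: "1 \<le> Max (set ns)"
    and ns: "\<forall>i<t. even (ns ! i) \<and> ns ! i > 0 \<and>
        real (ns ! i) \<ge> 2 * of_int \<lceil>log 2 (81 ^ t * real (Max (set ns)))\<rceil> + 2"
  define n where "n = Max (set ns)"
  define q :: nat where "q = 81 ^ t"
  define bound where "bound = 2 * 81 ^ (2 * t) * (real t * ln 81 + 1) * real n"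
  define M where "M = nat \<lfloor>bound\<rfloor>"
  \<comment> \<open>Consecutive intervals as sides make \<open>v < q * n\<close> the side
    indicator.\<close>
  define X where "X = {..<q * n}"
  define Y where "Y = {q * n..<2 * (q * n)}"
  have n0: "n > 0" using n1 by (simp add: n_def)
  have q0: "q > 0" by (simp add: q_def)
  have "bound \<ge> 0" by (simp add: bound_def)
  then have M: "real M \<le> bound" "bound < real M + 1" by (auto simp: M_def)
  have "2 * real q ^ 2 * (ln q + 1) * n = bound"
    by (simp add: bound_def q_def ln_realpow power_mult[symmetric] mult.commute)
  then obtain P where P: "P \<subseteq> X \<times> Y" "card P \<le> M"
    "\<And>A B. A \<subseteq> X \<Longrightarrow> B \<subseteq> Y \<Longrightarrow> card A = n \<Longrightarrow> card B = n \<Longrightarrow> P \<inter> A \<times> B \<noteq> {}"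
    using exists_sparse_joined_pairs[of X Y q n M] M n0 q0 by (auto simp: X_def Y_def)
  define E where "E = (\<lambda>(x, y). {x, y}) ` P"
  have finP: "finite P" using P(1) by (rule finite_subset) (auto simp: X_def Y_def)
  have cE: "card E \<le> M" using card_image_le[OF finP] P(2) unfolding E_def by (rule order.trans)
  have graph: "is_graph E"
    using finP P(1) by (auto simp: is_graph_def E_def X_def Y_def card_insert_if)
  have J: "joined E n X Y" unfolding joined_def
  proof (intro allI impI)
    fix A B assume "A \<subseteq> X" "B \<subseteq> Y" "card A = n \<and> card B = n"
    then have "P \<inter> A \<times> B \<noteq> {}" using P(3) by blast
    then show "\<exists>a\<in>A. \<exists>b\<in>B. {a, b} \<in> E" unfolding E_def by force
  qed
  have side: "(u < q * n) \<noteq> (v < q * n)" if "{u, v} \<in> E" for u v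
    using that P(1) by (auto simp: E_def X_def Y_def doubleton_eq_iff)
  have "cycle_arrows E ns" unfolding cycle_arrows_def len
  proof (intro allI impI)
    fix c :: "nat set \<Rightarrow> nat" assume c: "\<forall>e\<in>E. c e < t"
    show "\<exists>i<t. has_cycle {e\<in>E. c e = i} (ns ! i)"
    proof (rule joined_imp_monochromatic_cycle[OF J, where S = "\<lambda>v. v < q * n"])
      show "ns ! i \<le> n" if "i < t" for i using that len by (simp add: n_def)
      \<comment> \<open>Here \<open>d + 1\<close> is at most the logarithm, hence at most its
        ceiling, and the assumed bound becomes \<open>2 * (d + 1) + 2\<close>.\<close>
      show "2 * d + 4 \<le> ns ! i" if "i < t" "2 ^ (d + 1) \<le> 81 ^ t * n" for i d
      proof -
        have "real (2 ^ (d + 1)) \<le> real (81 ^ t * n)" using that(2) by (rule of_nat_mono)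
        then have "2 powr real (d + 1) \<le> 81 ^ t * real n"
          by (simp add: powr_add powr_realpow)
        then have "real (d + 1) \<le> log 2 (81 ^ t * real n)"
          using n0 by (subst le_log_iff) auto
        also have "\<dots> \<le> of_int \<lceil>log 2 (81 ^ t * real n)\<rceil>" by simp
        finally have "real (2 * d + 4) \<le> real (ns ! i)"
          using ns that(1) unfolding n_def by fastforce
        then show ?thesis by simp
      qed
    qed (use c ns n0 side in \<open>auto simp: X_def Y_def q_def\<close>)
  qed
  then have "size_ramsey_cycles ns \<le> card E"
    unfolding size_ramsey_cycles_def using graph by (intro Least_le) blast
  then have "real (size_ramsey_cycles ns) \<le> bound" using cE M by linarith
  then show "real (size_ramsey_cycles ns) \<le> 2 * 81 ^ (2 * t) * (real t * ln 81 + 1) * real (Max (set ns))"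
    unfolding bound_def n_def .
qed

end
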